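(* Let $\Sigma_1,\ldots,\Sigma_\nu$ be signed graphs of orders $n_1,\ldots,n_\nu$, let $\lambda_{i1}^L,\ldots,\lambda_{in_i}^L$ be the Laplacian eigenvalues of $\Sigma_i$, let $\Sigma=\Sigma_1\times\cdots\times\Sigma_\nu$ be the Cartesian product, and let $n=n_1\cdots n_\nu$. The Laplacian energy of $\Sigma$ is $$E_L(\Sigma)=\sum_{j_1=1}^{n_1}\cdots\sum_{j_\nu=1}^{n_\nu}\Big|\sum_{i=1}^\nu\lambda_{ij_i}^L-\bar d(\Sigma)\Big|,$$ and it satisfies $$\frac1nE_L(\Sigma)\le\sum_{i=1}^\nu\frac1{n_i}E_L(\Sigma_i).$$ The inequality is strict unless $\nu=1$ or at most one of the $\Sigma_i$ has any edges.
   Context: All graphs are finite (with nonempty vertex set), simple and loop-free. A signed graph $\Sigma=(G,\sigma)$ is a graph $G=(V,E)$ with a function $\sigma:E\to\{+1,-1\}$; its order is $|V|$. The adjacency matrix $A(\Sigma)$ has $(u,v)$ entry $\sigma(uv)$ if $u,v$ are adjacent and $0$ otherwise. The Laplacian matrix is $L(\Sigma)=D(\Sigma)-A(\Sigma)$, where $D(\Sigma)$ is the diagonal matrix of vertex degrees in $G$; its eigenvalues are the Laplacian eigenvalues. The average degree is $\bar d(\Sigma)=2|E|/|V|$, and the Laplacian energy is $E_L(\Sigma)=\sum_{j=1}^{|V|}|\lambda_j(L(\Sigma))-\bar d(\Sigma)|$, where $\lambda_j(L(\Sigma))$ are the eigenvalues of $L(\Sigma)$. The Cartesian product of signed graphs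 $\Sigma_i=(V_i,E_i,\sigma_i)$ is the signed graph on $V_1\times\cdots\times V_\nu$ in which $(u_1,\ldots,u_\nu)$ and $(v_1,\ldots,v_\nu)$ are adjacent iff there is an index $i$ with $u_iv_i\in E_i$ and $u_j=v_j$ for all $j\ne i$, such an edge having sign $\sigma_i(u_iv_i)$. *)

theory Defs
  imports
    Jordan_Normal_Form.Char_Poly
    "HOL-Library.FuncSet"
    "HOL-Library.Countable_Set"
begin

record 'a sgraph =
  verts :: "'a set"
  edges :: "'a set set"
  esign :: "'a set \<Rightarrow> real"

definition signed_graph :: "'a sgraph \<Rightarrow> bool" where
  "signed_graph S \<longleftrightarrow>
     finite (verts S) \<and> verts S \<noteq> {} \<and>
     (\<forall>e\<in>edges S. e \<subseteq> verts S \<and> card e = 2) \<and>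
     (\<forall>e\<in>edges S. esign S e \<in> {1, -1})"

definition vertex_degree :: "'a sgraph \<Rightarrow> 'a \<Rightarrow> nat" where
  "vertex_degree S v = card {e \<in> edges S. v \<in> e}"

text \<open>Matrices of \<^typ>\<open>'a mat\<close> are indexed by initial segments of the natural numbers;
  rows and columns follow the enumeration \<^term>\<open>from_nat_into (verts S)\<close> of the vertex set.
  A different enumeration gives a matrix similar to this one under a permutation.\<close>

definition adjacency_matrix :: "'a sgraph \<Rightarrow> real mat" where
  "adjacency_matrix S =
     mat (card (verts S)) (card (verts S)) (\<lambda>(i, j).
       let e = {from_nat_into (verts S) i, from_nat_into (verts S) j}
       in if e \<in> edges S then esign S e else 0)"

definition degree_matrix :: "'a sgraph \<Rightarrow> real mat" where
  "degree_matrix S =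
     mat (card (verts S)) (card (verts S)) (\<lambda>(i, j).
       if i = j then real (vertex_degree S (from_nat_into (verts S) i)) else 0)"

definition laplacian_matrix :: "'a sgraph \<Rightarrow> real mat" where
  "laplacian_matrix S = degree_matrix S - adjacency_matrix S"

text \<open>The eigenvalues with multiplicity. Only real roots of the characteristic polynomial are
  counted; no eigenvalue is lost, since the matrix is symmetric
  (lemma \<open>size_laplacian_eigenvalues\<close> below).\<close>

definition laplacian_eigenvalues :: "'a sgraph \<Rightarrow> real multiset" where
  "laplacian_eigenvalues S = proots (char_poly (laplacian_matrix S))"

definition avg_degree :: "'a sgraph \<Rightarrow> real" where
  "avg_degree S = 2 * real (card (edges S)) / real (card (verts S))"

definition laplacian_energy :: "'a sgraph \<Rightarrow> real" where
  "laplacian_energy S = (\<Sum>x\<in>#laplacian_eigenvalues S. \<bar>x - avg_degree S\<bar>)"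

text \<open>Vertices of the product are the extensional functions choosing a vertex of each factor.
  For an edge \<open>e = {u, v}\<close>, the image of \<open>e\<close> under the projection to coordinate \<open>i\<close> is
  \<open>{u i, v i}\<close>; this is an edge of the \<open>i\<close>-th factor for exactly one \<open>i\<close>, as the other
  projections are singletons. The sign of \<open>e\<close> is the sign of that projected edge.\<close>

definition cartesian_product :: "nat \<Rightarrow> (nat \<Rightarrow> 'a sgraph) \<Rightarrow> (nat \<Rightarrow> 'a) sgraph" where
  "cartesian_product \<nu> S =
     \<lparr>verts = (\<Pi>\<^sub>E i\<in>{1..\<nu>}. verts (S i)),
      edges = {{u, v} | u v.
        u \<in> (\<Pi>\<^sub>E i\<in>{1..\<nu>}. verts (S i)) \<and> v \<in> (\<Pi>\<^sub>E i\<in>{1..\<nu>}. verts (S i)) \<and>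
        (\<exists>i\<in>{1..\<nu>}. {u i, v i} \<in> edges (S i) \<and> (\<forall>j\<in>{1..\<nu>} - {i}. u j = v j))},
      esign = (\<lambda>e.
        let i = (THE i. i \<in> {1..\<nu>} \<and> (\<lambda>u. u i) ` e \<in> edges (S i))
        in esign (S i) ((\<lambda>u. u i) ` e))\<rparr>"

lemma cartesian_product_esign:
  assumes S: "\<And>i. i \<in> {1..\<nu>} \<Longrightarrow> signed_graph (S i)"
    and i: "i \<in> {1..\<nu>}" and e: "{u i, v i} \<in> edges (S i)"
    and eq: "\<And>j. j \<in> {1..\<nu>} - {i} \<Longrightarrow> u j = v j"
  shows "esign (cartesian_product \<nu> S) {u, v} = esign (S i) {u i, v i}"
proof -
  have "(THE k. k \<in> {1..\<nu>} \<and> (\<lambda>w. w k) ` {u, v} \<in> edges (S k)) = i"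
  proof (rule the_equality)
    show "i \<in> {1..\<nu>} \<and> (\<lambda>w. w i) ` {u, v} \<in> edges (S i)"
      using i e by simp
  next
    fix k assume k: "k \<in> {1..\<nu>} \<and> (\<lambda>w. w k) ` {u, v} \<in> edges (S k)"
    show "k = i"
    proof (rule ccontr)
      assume "k \<noteq> i"
      with k eq have "u k = v k" by auto
      with k have "{v k} \<in> edges (S k)" by simp
      with S[of k] k have "card {v k} = 2" unfolding signed_graph_def by blast
      then show False by simp
    qed
  qed
  then show ?thesis by (simp add: cartesian_product_def)
qed

lemma signed_graph_cartesian_product:
  assumes S: "\<And>i. i \<in> {1..\<nu>} \<Longrightarrow> signed_graph (S i)"
  shows "signed_graph (cartesian_product \<nu> S)"
proof -
  let ?P = "cartesian_product \<nu> S"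
  have "finite (verts ?P)" "verts ?P \<noteq> {}"
    using S unfolding cartesian_product_def signed_graph_def
    by (auto intro!: finite_PiE simp: PiE_eq_empty_iff)
  moreover have "e \<subseteq> verts ?P \<and> card e = 2 \<and> esign ?P e \<in> {1, -1}" if "e \<in> edges ?P" for e
  proof -
    from that obtain u v i where e: "e = {u, v}" and uv: "u \<in> verts ?P" "v \<in> verts ?P"
      and i: "i \<in> {1..\<nu>}" and ei: "{u i, v i} \<in> edges (S i)"
      and eq: "\<And>j. j \<in> {1..\<nu>} - {i} \<Longrightarrow> u j = v j"
      unfolding cartesian_product_def by auto
    have "card {u i, v i} = 2" and sg: "esign (S i) {u i, v i} \<in> {1, -1}"
      using S[OF i] ei unfolding signed_graph_def by blast+
    then have "u \<noteq> v" by auto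
    then show ?thesis
      using e uv sg cartesian_product_esign[of \<nu> S i u v, OF S i ei eq] by auto
  qed
  ultimately show ?thesis unfolding signed_graph_def by blast
qed

lemma size_laplacian_eigenvalues:
  "size (laplacian_eigenvalues S) = card (verts S)"
proof -
  define n where "n = card (verts S)"
  define A where "A = laplacian_matrix S"
  define B where "B = map_mat complex_of_real A"
  have A: "A \<in> carrier_mat n n"
    unfolding A_def n_def laplacian_matrix_def degree_matrix_def adjacency_matrix_def
    by (intro minus_carrier_mat mat_carrier)
  have symA: "A $$ (i, j) = A $$ (j, i)" if "i < n" "j < n" for i j
    using that
    by (auto simp: A_def n_def laplacian_matrix_def degree_matrix_def adjacency_matrix_def
        Let_def insert_commute)
  have B: "B \<in> carrier_mat n n" using A by (simp add: B_def)
  have cpB: "char_poly B = map_poly complex_of_real (char_poly A)"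
    unfolding B_def by (rule of_real_hom.char_poly_hom[OF A])
  obtain as where as: "char_poly B = (\<Prod>a\<leftarrow>as. [:- a, 1:])" and len: "length as = n"
    using char_poly_factorized[OF B] by blast
  have real: "a \<in> \<real>" if "a \<in> set as" for a
  proof -
    have "poly (char_poly B) a = 0"
      using that unfolding as by (auto simp: poly_prod_list prod_list_zero_iff)
    then have "eigenvalue B a" using eigenvalue_root_char_poly[OF B] by simp
    then obtain v where "eigenvector B v a" unfolding eigenvalue_def by blast
    then have v: "v \<in> carrier_vec n" "v \<noteq> 0\<^sub>v n" and Bv: "B *\<^sub>v v = a \<cdot>\<^sub>v v"
      using B unfolding eigenvector_def by auto
    have row: "(\<Sum>j<n. of_real (A $$ (i, j)) * v $ j) = a * v $ i" if "i < n" for i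
    proof -
      have "(B *\<^sub>v v) $ i = (\<Sum>j<n. of_real (A $$ (i, j)) * v $ j)"
        using that A v by (auto simp: B_def scalar_prod_def lessThan_atLeast0 intro!: sum.cong)
      then show ?thesis using Bv that v by simp
    qed
    define q where "q = (\<Sum>i<n. cnj (v $ i) * (\<Sum>j<n. of_real (A $$ (i, j)) * v $ j))"
    define N where "N = (\<Sum>i<n. (cmod (v $ i))\<^sup>2)"
    have "q = (\<Sum>i<n. a * (v $ i * cnj (v $ i)))"
      unfolding q_def by (intro sum.cong) (auto simp: row)
    then have q1: "q = a * of_real N"
      by (simp add: N_def sum_distrib_left complex_norm_square del: of_real_power)
    have "cnj q = (\<Sum>i<n. \<Sum>j<n. v $ i * of_real (A $$ (i, j)) * cnj (v $ j))"
      by (simp add: q_def sum_distrib_left mult_ac)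
    also have "\<dots> = (\<Sum>j<n. \<Sum>i<n. v $ i * of_real (A $$ (i, j)) * cnj (v $ j))"
      by (rule sum.swap)
    also have "\<dots> = q"
      unfolding q_def sum_distrib_left by (intro sum.cong) (auto simp: symA mult_ac)
    finally have q2: "cnj q = q" .
    obtain i where "i < n" "v $ i \<noteq> 0"
      using v by (metis carrier_vecD eq_vecI index_zero_vec)
    then have "N > 0"
      unfolding N_def by (intro sum_pos2[of _ i]) auto
    then have "cnj a = a" using q1 q2 by simp
    then show ?thesis by (simp add: Reals_cnj_iff)
  qed
  interpret h: map_poly_inj_idom_hom complex_of_real ..
  have "map_poly complex_of_real (char_poly A) = (\<Prod>a\<leftarrow>as. [:- complex_of_real (Re a), 1:])"
  proof -
    have "map (\<lambda>a. [:- a, 1:]) as = map (\<lambda>a. [:- complex_of_real (Re a), 1:]) as"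
      using real by (auto simp: of_real_Re)
    then show ?thesis unfolding cpB[symmetric] as by (rule arg_cong)
  qed
  also have "\<dots> = map_poly complex_of_real (\<Prod>a\<leftarrow>map Re as. [:- a, 1:])"
    unfolding h.hom_prod_list by (rule arg_cong[where f = prod_list]) simp
  finally have "char_poly A = (\<Prod>a\<leftarrow>map Re as. [:- a, 1:])"
    by (rule h.injectivity)
  moreover have "proots (\<Prod>a\<leftarrow>bs. [:- a, 1:]) = mset bs" for bs :: "real list"
  proof (induction bs)
    case (Cons b bs)
    have "(\<Prod>a\<leftarrow>bs. [:- a, 1:]) \<noteq> 0" by (auto simp: prod_list_zero_iff)
    with Cons show ?case by (simp only: list.map prod_list.Cons) (subst proots_mult, auto)
  qed simp
  ultimately have "laplacian_eigenvalues S = mset (map Re as)"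
    unfolding laplacian_eigenvalues_def A_def[symmetric] by (simp only:)
  then show ?thesis using len by (simp add: n_def)
qed

end

theory Submission
  imports Defs Jordan_Normal_Form.Schur_Decomposition
begin

text \<open>The Laplacian of the product is the Kronecker sum of the factors' Laplacians. Bases that
  triangularize the factors (Schur) tensor to a basis that triangularizes the Kronecker sum, with
  the sums of the eigenvalues on the diagonal; no orthogonal diagonalization is needed. Since the
  average degree is additive too, the inequality is the triangle inequality applied to the
  deviations \<open>\<lambda> - a\<close> of the eigenvalues from the average degree of each factor, averaged over
  all index tuples. In a factor with edges, these
  deviations sum to \<open>0\<close> without all vanishing, so both signs occur; with two such factors some
  index tuple combines deviations of opposite sign, where the triangle inequality is strict.\<close>

section \<open>Matrices indexed by finite sets, and their triangularization\<close>

text \<open>Rows and columns have separate enumerations, so that a change of basis from vertices to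
  eigenvalue indices also has this form. Identities between functions on finite sets thus pass to
  library matrices and back.\<close>

definition fun_mat :: "nat \<Rightarrow> (nat \<Rightarrow> 'v) \<Rightarrow> (nat \<Rightarrow> 'k) \<Rightarrow> ('v \<Rightarrow> 'k \<Rightarrow> real) \<Rightarrow> real mat" where
  "fun_mat n e d X = mat n n (\<lambda>(a, b). X (e a) (d b))"

lemma fun_mat_carrier [simp]: "fun_mat n e d X \<in> carrier_mat n n"
  by (simp add: fun_mat_def)

lemma fun_mat_mult:
  assumes "bij_betw d {..<n} K"
  shows "fun_mat n e d X * fun_mat n d c Y = fun_mat n e c (\<lambda>u w. \<Sum>k\<in>K. X u k * Y k w)"
proof (rule eq_matI)
  fix a b assume "a < dim_row (fun_mat n e c (\<lambda>u w. \<Sum>k\<in>K. X u k * Y k w))"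
    and "b < dim_col (fun_mat n e c (\<lambda>u w. \<Sum>k\<in>K. X u k * Y k w))"
  then have ab: "a < n" "b < n" by (auto simp: fun_mat_def)
  have "(\<Sum>k\<in>K. X (e a) k * Y k (c b)) = (\<Sum>i<n. X (e a) (d i) * Y (d i) (c b))"
    by (rule sum.reindex_bij_betw[OF assms, symmetric])
  with ab show "(fun_mat n e d X * fun_mat n d c Y) $$ (a, b) =
      fun_mat n e c (\<lambda>u w. \<Sum>k\<in>K. X u k * Y k w) $$ (a, b)"
    by (auto simp: fun_mat_def scalar_prod_def lessThan_atLeast0)
qed (auto simp: fun_mat_def)

lemma fun_mat_eq_iff:
  assumes "bij_betw e {..<n} V" "bij_betw d {..<n} K"
  shows "fun_mat n e d X = fun_mat n e d Y \<longleftrightarrow> (\<forall>u\<in>V. \<forall>k\<in>K. X u k = Y u k)"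
proof
  assume eq: "fun_mat n e d X = fun_mat n e d Y"
  have "X (e a) (d b) = Y (e a) (d b)" if "a < n" "b < n" for a b
    using arg_cong[OF eq, of "\<lambda>M. M $$ (a, b)"] that by (simp add: fun_mat_def)
  then show "\<forall>u\<in>V. \<forall>k\<in>K. X u k = Y u k"
    using assms by (auto simp: bij_betw_def)
next
  assume "\<forall>u\<in>V. \<forall>k\<in>K. X u k = Y u k"
  then show "fun_mat n e d X = fun_mat n e d Y"
    using assms by (auto simp: fun_mat_def bij_betw_def intro!: eq_matI)
qed

lemma fun_mat_one:
  assumes "bij_betw e {..<n} V"
  shows "fun_mat n e e (\<lambda>u v. of_bool (u = v)) = 1\<^sub>m n"
  using assms by (auto simp: fun_mat_def bij_betw_def inj_on_def intro!: eq_matI)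

text \<open>Serves to pull the matrices returned by the Schur decomposition back to functions on
  \<open>V\<close> and \<open>K\<close>.\<close>

lemma fun_mat_surj:
  assumes "bij_betw e {..<n} V" "bij_betw d {..<n} K" "M \<in> carrier_mat n n"
  shows "\<exists>X. M = fun_mat n e d X"
proof
  show "M = fun_mat n e d (\<lambda>u k. M $$ (the_inv_into {..<n} e u, the_inv_into {..<n} d k))"
    using assms by (auto simp: fun_mat_def bij_betw_def the_inv_into_f_f intro!: eq_matI)
qed

text \<open>A matrix is represented by its entry function on arbitrary finite index sets. The columns of
  \<open>F\<close> are a basis, with inverse \<open>G\<close>, in which \<open>L\<close> becomes \<open>T\<close>; triangularity of \<open>T\<close> is measured
  by a rank function \<open>key\<close> with possible ties, so that it survives tensor products, where the
  ranks of the factors add up.\<close>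

definition triangularizes ::
  "'v set \<Rightarrow> 'k set \<Rightarrow> ('v \<Rightarrow> 'v \<Rightarrow> real) \<Rightarrow>
   ('v \<Rightarrow> 'k \<Rightarrow> real) \<Rightarrow> ('k \<Rightarrow> 'v \<Rightarrow> real) \<Rightarrow> ('k \<Rightarrow> 'k \<Rightarrow> real) \<Rightarrow> ('k \<Rightarrow> nat) \<Rightarrow> bool"
where
  "triangularizes V K L F G T key \<longleftrightarrow>
     (\<forall>u\<in>V. \<forall>j\<in>K. (\<Sum>v\<in>V. L u v * F v j) = (\<Sum>k\<in>K. F u k * T k j)) \<and>
     (\<forall>u\<in>V. \<forall>v\<in>V. (\<Sum>k\<in>K. F u k * G k v) = of_bool (u = v)) \<and>
     (\<forall>j\<in>K. \<forall>k\<in>K. (\<Sum>v\<in>V. G j v * F v k) = of_bool (j = k)) \<and>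
     (\<forall>j\<in>K. \<forall>k\<in>K. T j k \<noteq> 0 \<longrightarrow> j = k \<or> key j < key k)"

lemma prod_list_upt: "(\<Prod>a\<leftarrow>map f [0..<n]. g a) = (\<Prod>a<n. g (f a))"
  for g :: "'b \<Rightarrow> 'c :: comm_monoid_mult"
  by (induction n) (auto simp: mult.commute)

text \<open>The Schur decomposition accepts the eigenvalues in any prescribed order, so the diagonal
  can be made to follow the given labelling \<open>l\<close> of \<open>K\<close>.\<close>

lemma triangularizes_exists:
  assumes e: "bij_betw e {..<n} V" and K: "finite K" "card K = n"
    and cp: "char_poly (fun_mat n e e L) = (\<Prod>k\<in>K. [:- l k, 1:])"
  shows "\<exists>F G T key. triangularizes V K L F G T key \<and> (\<forall>k\<in>K. T k k = l k)"
proof -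
  obtain d where d: "bij_betw d {..<n} K"
    using ex_bij_betw_nat_finite[OF K(1)] K(2) by (auto simp: lessThan_atLeast0)
  define es where "es = map (\<lambda>a. l (d a)) [0..<n]"
  let ?A = "fun_mat n e e L"
  have A: "?A \<in> carrier_mat n n" by simp
  have "char_poly ?A = (\<Prod>x\<leftarrow>es. [:- x, 1:])"
    unfolding cp es_def prod_list_upt
    by (rule prod.reindex_bij_betw[OF d, symmetric])
  moreover obtain B P Q where "schur_decomposition ?A es = (B, P, Q)"
    by (cases "schur_decomposition ?A es")
  ultimately have sim: "similar_mat_wit ?A B P Q" and ut: "upper_triangular B"
    and diag: "diag_mat B = es"
    using schur_decomposition[OF A] by blast+
  note w = similar_mat_witD2[OF A sim]
  obtain F where F: "P = fun_mat n e d F" using fun_mat_surj[OF e d w(6)] by blast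
  obtain G where G: "Q = fun_mat n d e G" using fun_mat_surj[OF d e w(7)] by blast
  obtain T where T: "B = fun_mat n d d T" using fun_mat_surj[OF d d w(5)] by blast
  \<comment> \<open>Multiply \<open>?A = P * B * Q\<close> by \<open>P\<close> on the right;
    \<open>Q * P\<close> then cancels.\<close>
  have "?A * P = P * B * (Q * P)"
    using w by (simp add: assoc_mult_mat[of _ n n _ n _ n])
  then have "?A * P = P * B" using w by simp
  then have 1: "\<forall>u\<in>V. \<forall>j\<in>K. (\<Sum>v\<in>V. L u v * F v j) = (\<Sum>k\<in>K. F u k * T k j)"
    unfolding F T fun_mat_mult[OF e] fun_mat_mult[OF d] fun_mat_eq_iff[OF e d] .
  have 2: "\<forall>u\<in>V. \<forall>v\<in>V. (\<Sum>k\<in>K. F u k * G k v) = of_bool (u = v)"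
    using w(1) unfolding F G fun_mat_mult[OF d] fun_mat_one[OF e, symmetric] fun_mat_eq_iff[OF e e] .
  have 3: "\<forall>j\<in>K. \<forall>k\<in>K. (\<Sum>v\<in>V. G j v * F v k) = of_bool (j = k)"
    using w(2) unfolding F G fun_mat_mult[OF e] fun_mat_one[OF d, symmetric] fun_mat_eq_iff[OF d d] .
  \<comment> \<open>The rank is the position in the enumeration \<open>d\<close>, so upper
    triangularity says that a nonzero off-diagonal entry goes from a smaller to a larger
    rank.\<close>
  define key where "key = the_inv_into {..<n} d"
  have key: "key (d a) = a" if "a < n" for a
    using d that by (simp add: key_def the_inv_into_f_f bij_betw_def)
  have "T (d a) (d b) = 0" if "b < a" "a < n" for a b
    using ut that unfolding T upper_triangular_def by (auto simp: fun_mat_def)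
  then have "T (d a) (d b) \<noteq> 0 \<longrightarrow> d a = d b \<or> key (d a) < key (d b)" if "a < n" "b < n" for a b
    using that by (cases a b rule: linorder_cases) (auto simp: key)
  then have 4: "\<forall>j\<in>K. \<forall>k\<in>K. T j k \<noteq> 0 \<longrightarrow> j = k \<or> key j < key k"
    using d by (auto simp: bij_betw_def)
  have "T (d a) (d a) = l (d a)" if "a < n" for a
    using arg_cong[OF diag, of "\<lambda>xs. xs ! a"] that w(5)
    by (simp add: es_def diag_mat_def T) (simp add: fun_mat_def)
  then have "\<forall>k\<in>K. T k k = l k" using d by (auto simp: bij_betw_def)
  with 1 2 3 4 show ?thesis unfolding triangularizes_def by blast
qed

text \<open>Enumerating \<open>K\<close> by increasing \<open>key\<close> turns \<open>T\<close>
  into an upper triangular matrix similar to the matrix of \<open>L\<close>.\<close>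

lemma char_poly_triangularizes:
  assumes tr: "triangularizes V K L F G T key"
    and e: "bij_betw e {..<n} V" and K: "finite K" "card K = n"
  shows "char_poly (fun_mat n e e L) = (\<Prod>k\<in>K. [:- T k k, 1:])"
proof -
  obtain ys where ys: "set ys = K" "distinct ys" using finite_distinct_list[OF K(1)] by blast
  define xs where "xs = sort_key key ys"
  have xs: "set xs = K" "distinct xs" "sorted (map key xs)" "length xs = n"
    using ys K by (auto simp: xs_def distinct_card)
  define d where "d = (\<lambda>a. xs ! a)"
  have d: "bij_betw d {..<n} K"
    unfolding d_def using bij_betw_nth[OF xs(2), of "{..<n}" K] xs by auto
  let ?A = "fun_mat n e e L" and ?B = "fun_mat n d d T"
  let ?P = "fun_mat n e d F" and ?Q = "fun_mat n d e G"
  have "?A * ?P = ?P * ?B"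
    using tr unfolding fun_mat_mult[OF e] fun_mat_mult[OF d] fun_mat_eq_iff[OF e d] triangularizes_def
    by blast
  moreover have PQ: "?P * ?Q = 1\<^sub>m n"
    using tr unfolding fun_mat_mult[OF d] fun_mat_one[OF e, symmetric] fun_mat_eq_iff[OF e e]
      triangularizes_def by blast
  moreover have QP: "?Q * ?P = 1\<^sub>m n"
    using tr unfolding fun_mat_mult[OF e] fun_mat_one[OF d, symmetric] fun_mat_eq_iff[OF d d]
      triangularizes_def by blast
  ultimately have "?P * ?B * ?Q = ?A * (?P * ?Q)"
    by (metis assoc_mult_mat[of ?A n n ?P n ?Q n] fun_mat_carrier)
  then have "?A = ?P * ?B * ?Q" by (simp add: PQ right_mult_one_mat[of ?A n n])
  moreover have "{?A, ?B, ?P, ?Q} \<subseteq> carrier_mat n n" by simp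
  ultimately have "similar_mat ?A ?B"
    using PQ QP by (intro similar_matI)
  then have "char_poly ?A = char_poly ?B" by (rule char_poly_similar)
  also have "\<dots> = (\<Prod>x\<leftarrow>diag_mat ?B. [:- x, 1:])"
  proof (rule char_poly_upper_triangular[of _ n])
    \<comment> \<open>Ties are harmless: a nonzero entry with \<open>d a \<noteq> d b\<close> would
      need \<open>key (d a) < key (d b)\<close>, while sorting gives
      \<open>key (d b) \<le> key (d a)\<close>.\<close>
    have "T (d a) (d b) = 0" if "b < a" "a < n" for a b
    proof -
      have "d a \<noteq> d b" "d a \<in> K" "d b \<in> K"
        using xs that by (auto simp: d_def nth_eq_iff_index_eq)
      moreover have "key (d b) \<le> key (d a)"
        using sorted_nth_mono[OF xs(3), of b a] that xs by (simp add: d_def)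
      ultimately show ?thesis using tr unfolding triangularizes_def by force
    qed
    then show "upper_triangular ?B" by (auto simp: fun_mat_def)
  qed simp
  also have "diag_mat ?B = map (\<lambda>a. T (d a) (d a)) [0..<n]"
    by (auto simp: diag_mat_def fun_mat_def)
  also have "(\<Prod>x\<leftarrow>\<dots>. [:- x, 1:]) = (\<Prod>k\<in>K. [:- T k k, 1:])"
    unfolding prod_list_upt by (rule prod.reindex_bij_betw[OF d])
  finally show ?thesis .
qed

section \<open>Traces of a matrix and of its square\<close>

text \<open>Insert the identity \<open>F G\<close>, replace \<open>L F\<close> by
  \<open>F T\<close>, and move \<open>F\<close> around cyclically to cancel against
  \<open>G\<close>. Triangularity is not assumed, so the argument also covers the squares of
  \<open>L\<close> and \<open>T\<close>.\<close>

lemma trace_conj: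
  fixes L :: "'v \<Rightarrow> 'v \<Rightarrow> real" and T :: "'k \<Rightarrow> 'k \<Rightarrow> real"
  assumes V: "finite V" and K: "finite K"
    and LF: "\<And>u j. u \<in> V \<Longrightarrow> j \<in> K \<Longrightarrow> (\<Sum>v\<in>V. L u v * F v j) = (\<Sum>k\<in>K. F u k * T k j)"
    and FG: "\<And>u v. u \<in> V \<Longrightarrow> v \<in> V \<Longrightarrow> (\<Sum>k\<in>K. F u k * G k v) = of_bool (u = v)"
    and GF: "\<And>j k. j \<in> K \<Longrightarrow> k \<in> K \<Longrightarrow> (\<Sum>v\<in>V. G j v * F v k) = of_bool (j = k)"
  shows "(\<Sum>u\<in>V. L u u) = (\<Sum>k\<in>K. T k k)"
proof -
  have "(\<Sum>u\<in>V. L u u) = (\<Sum>u\<in>V. \<Sum>v\<in>V. L u v * (\<Sum>k\<in>K. F v k * G k u))"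
    using V by (intro sum.cong refl) (simp add: FG)
  also have "\<dots> = (\<Sum>u\<in>V. \<Sum>k\<in>K. (\<Sum>v\<in>V. L u v * F v k) * G k u)"
    unfolding sum_distrib_left sum_distrib_right mult.assoc by (intro sum.cong refl) (rule sum.swap)
  also have "\<dots> = (\<Sum>u\<in>V. \<Sum>k\<in>K. \<Sum>j\<in>K. F u j * T j k * G k u)"
    by (simp add: LF sum_distrib_right)
  also have "\<dots> = (\<Sum>k\<in>K. \<Sum>u\<in>V. \<Sum>j\<in>K. F u j * T j k * G k u)"
    by (rule sum.swap)
  also have "\<dots> = (\<Sum>k\<in>K. \<Sum>j\<in>K. \<Sum>u\<in>V. F u j * T j k * G k u)"
    by (intro sum.cong refl) (rule sum.swap)
  also have "\<dots> = (\<Sum>k\<in>K. \<Sum>j\<in>K. T j k * (\<Sum>u\<in>V. G k u * F u j))"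
    by (simp add: sum_distrib_left mult_ac)
  also have "\<dots> = (\<Sum>k\<in>K. T k k)"
    using K by (simp add: GF)
  finally show ?thesis .
qed

lemma trace_triangularizes:
  assumes tr: "triangularizes V K L F G T key" and V: "finite V" and K: "finite K"
  shows "(\<Sum>u\<in>V. L u u) = (\<Sum>k\<in>K. T k k)"
    and "(\<Sum>u\<in>V. \<Sum>v\<in>V. L u v * L v u) = (\<Sum>k\<in>K. (T k k)\<^sup>2)"
proof -
  have LF: "(\<Sum>v\<in>V. L u v * F v j) = (\<Sum>k\<in>K. F u k * T k j)" if "u \<in> V" "j \<in> K" for u j
    using tr that by (simp add: triangularizes_def)
  have FG: "(\<Sum>k\<in>K. F u k * G k v) = of_bool (u = v)" if "u \<in> V" "v \<in> V" for u v
    using tr that by (simp add: triangularizes_def)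
  have GF: "(\<Sum>v\<in>V. G j v * F v k) = of_bool (j = k)" if "j \<in> K" "k \<in> K" for j k
    using tr that by (simp add: triangularizes_def)
  show "(\<Sum>u\<in>V. L u u) = (\<Sum>k\<in>K. T k k)"
    by (rule trace_conj[OF V K LF FG GF])
  \<comment> \<open>The squares satisfy the same intertwining relation, by moving \<open>L\<close>
    past \<open>F\<close> twice.\<close>
  have "(\<Sum>u\<in>V. \<Sum>v\<in>V. L u v * L v u) = (\<Sum>j\<in>K. \<Sum>k\<in>K. T j k * T k j)"
  proof (rule trace_conj[where L = "\<lambda>u v. \<Sum>w\<in>V. L u w * L w v"
        and T = "\<lambda>j k. \<Sum>i\<in>K. T j i * T i k", OF V K _ FG GF])
    fix u j assume u: "u \<in> V" and j: "j \<in> K"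
    have "(\<Sum>v\<in>V. (\<Sum>w\<in>V. L u w * L w v) * F v j) = (\<Sum>w\<in>V. L u w * (\<Sum>v\<in>V. L w v * F v j))"
      unfolding sum_distrib_left sum_distrib_right mult.assoc by (rule sum.swap)
    also have "\<dots> = (\<Sum>w\<in>V. \<Sum>k\<in>K. L u w * F w k * T k j)"
      using j by (simp add: LF sum_distrib_left mult.assoc)
    also have "\<dots> = (\<Sum>k\<in>K. (\<Sum>w\<in>V. L u w * F w k) * T k j)"
      unfolding sum_distrib_right by (rule sum.swap)
    also have "\<dots> = (\<Sum>k\<in>K. \<Sum>i\<in>K. F u i * (T i k * T k j))"
      using u by (simp add: LF sum_distrib_right mult.assoc)
    also have "\<dots> = (\<Sum>i\<in>K. F u i * (\<Sum>k\<in>K. T i k * T k j))"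
      unfolding sum_distrib_left by (rule sum.swap)
    finally show "(\<Sum>v\<in>V. (\<Sum>w\<in>V. L u w * L w v) * F v j) =
      (\<Sum>i\<in>K. F u i * (\<Sum>k\<in>K. T i k * T k j))" .
  qed
  \<comment> \<open>For \<open>j \<noteq> k\<close> the entries \<open>T j k\<close> and
    \<open>T k j\<close> cannot both be nonzero, since the rank would have to increase in both
    directions.\<close>
  also have "\<dots> = (\<Sum>j\<in>K. \<Sum>k\<in>K. if k = j then (T j j)\<^sup>2 else 0)"
  proof (intro sum.cong refl)
    fix j k assume "j \<in> K" "k \<in> K"
    then have "T j k \<noteq> 0 \<longrightarrow> j = k \<or> key j < key k" "T k j \<noteq> 0 \<longrightarrow> k = j \<or> key k < key j"
      using tr unfolding triangularizes_def by blast+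
    then show "T j k * T k j = (if k = j then (T j j)\<^sup>2 else 0)"
      by (auto simp: power2_eq_square)
  qed
  also have "\<dots> = (\<Sum>j\<in>K. (T j j)\<^sup>2)" using K by simp
  finally show "(\<Sum>u\<in>V. \<Sum>v\<in>V. L u v * L v u) = (\<Sum>k\<in>K. (T k k)\<^sup>2)" .
qed

section \<open>Kronecker sums\<close>

text \<open>Summand \<open>i\<close> is the entry of the tensor product with \<open>L i\<close> in
  position \<open>i\<close> and identity matrices in all others.\<close>

definition kron_sum ::
  "'i set \<Rightarrow> ('i \<Rightarrow> 'v \<Rightarrow> 'v \<Rightarrow> real) \<Rightarrow> ('i \<Rightarrow> 'v) \<Rightarrow> ('i \<Rightarrow> 'v) \<Rightarrow> real" where
  "kron_sum I L u v = (\<Sum>i\<in>I. \<Prod>l\<in>I. if l = i then L l (u l) (v l) else of_bool (u l = v l))"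

lemma prod_of_bool_PiE:
  assumes "finite I" "u \<in> PiE I V" "v \<in> PiE I V"
  shows "(\<Prod>i\<in>I. of_bool (u i = v i)) = (of_bool (u = v) :: real)"
proof (cases "u = v")
  case False
  then obtain i where "i \<in> I" "u i \<noteq> v i" using PiE_ext[OF assms(2,3)] by blast
  with assms(1) False show ?thesis by (auto intro!: prod_zero)
qed simp

text \<open>Sums over tuples of products over coordinates factor into products of sums, so each
  identity reduces to the one in the single factors. Triangularity survives because the ranks are
  added.\<close>

lemma triangularizes_kron_sum:
  assumes I: "finite I" and V: "\<And>i. i \<in> I \<Longrightarrow> finite (V i)" and K: "\<And>i. i \<in> I \<Longrightarrow> finite (K i)"
    and tr: "\<And>i. i \<in> I \<Longrightarrow> triangularizes (V i) (K i) (L i) (F i) (G i) (T i) (key i)"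
  shows "triangularizes (PiE I V) (PiE I K) (kron_sum I L)
    (\<lambda>u j. \<Prod>i\<in>I. F i (u i) (j i)) (\<lambda>j u. \<Prod>i\<in>I. G i (j i) (u i))
    (kron_sum I T) (\<lambda>j. \<Sum>i\<in>I. key i (j i))"
  unfolding triangularizes_def
proof (intro conjI ballI impI, goal_cases)
  case (1 u j)
  have ui: "u i \<in> V i" and ji: "j i \<in> K i" if "i \<in> I" for i using 1 that by auto
  have "(\<Sum>v\<in>PiE I V. kron_sum I L u v * (\<Prod>i\<in>I. F i (v i) (j i))) =
      (\<Sum>i\<in>I. \<Sum>v\<in>PiE I V. \<Prod>l\<in>I.
        (if l = i then L l (u l) (v l) else of_bool (u l = v l)) * F l (v l) (j l))"
    unfolding kron_sum_def sum_distrib_right prod.distrib[symmetric] by (rule sum.swap)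
  also have "\<dots> = (\<Sum>i\<in>I. \<Prod>l\<in>I. \<Sum>x\<in>V l.
        (if l = i then L l (u l) x else of_bool (u l = x)) * F l x (j l))"
    by (subst prod_sum_PiE[OF I V]) auto
  \<comment> \<open>For \<open>l = i\<close> this is the relation \<open>L F = F T\<close> of that
    factor; for the other \<open>l\<close> both sums collapse to
    \<open>F l (u l) (j l)\<close>.\<close>
  also have "\<dots> = (\<Sum>i\<in>I. \<Prod>l\<in>I. \<Sum>k\<in>K l.
        F l (u l) k * (if l = i then T l k (j l) else of_bool (k = j l)))"
  proof (intro sum.cong prod.cong refl)
    fix i l assume "i \<in> I" "l \<in> I"
    then show "(\<Sum>x\<in>V l. (if l = i then L l (u l) x else of_bool (u l = x)) * F l x (j l)) =
        (\<Sum>k\<in>K l. F l (u l) k * (if l = i then T l k (j l) else of_bool (k = j l)))"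
      using tr[of l] ui[of l] ji[of l] V[of l] K[of l]
      by (cases "l = i") (simp_all add: triangularizes_def)
  qed
  also have "\<dots> = (\<Sum>i\<in>I. \<Sum>k\<in>PiE I K. \<Prod>l\<in>I.
        F l (u l) (k l) * (if l = i then T l (k l) (j l) else of_bool (k l = j l)))"
    by (subst prod_sum_PiE[OF I K]) auto
  also have "\<dots> = (\<Sum>k\<in>PiE I K. (\<Prod>i\<in>I. F i (u i) (k i)) * kron_sum I T k j)"
    unfolding kron_sum_def sum_distrib_left prod.distrib[symmetric] by (rule sum.swap)
  finally show ?case .
next
  case (2 u v)
  have "(\<Sum>k\<in>PiE I K. (\<Prod>i\<in>I. F i (u i) (k i)) * (\<Prod>i\<in>I. G i (k i) (v i))) =
      (\<Prod>i\<in>I. \<Sum>k\<in>K i. F i (u i) k * G i k (v i))"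
    by (subst prod_sum_PiE[OF I K]) (auto simp: prod.distrib)
  also have "\<dots> = (\<Prod>i\<in>I. of_bool (u i = v i))"
    using 2 tr by (intro prod.cong) (auto simp: triangularizes_def PiE_mem)
  finally show ?case using prod_of_bool_PiE[OF I 2] by simp
next
  case (3 j k)
  have "(\<Sum>v\<in>PiE I V. (\<Prod>i\<in>I. G i (j i) (v i)) * (\<Prod>i\<in>I. F i (v i) (k i))) =
      (\<Prod>i\<in>I. \<Sum>x\<in>V i. G i (j i) x * F i x (k i))"
    by (subst prod_sum_PiE[OF I V]) (auto simp: prod.distrib)
  also have "\<dots> = (\<Prod>i\<in>I. of_bool (j i = k i))"
    using 3 tr by (intro prod.cong) (auto simp: triangularizes_def PiE_mem)
  finally show ?case using prod_of_bool_PiE[OF I 3] by simp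
next
  case (4 j k)
  \<comment> \<open>A nonzero entry has a nonzero summand \<open>i\<close>. Its identity factors
    force \<open>j\<close> and \<open>k\<close> to agree off \<open>i\<close>, so either the tuples
    coincide or only the rank in coordinate \<open>i\<close> changes, and it grows.\<close>
  then obtain i where i: "i \<in> I"
    and nz: "(\<Prod>l\<in>I. if l = i then T l (j l) (k l) else of_bool (j l = k l)) \<noteq> 0"
    unfolding kron_sum_def by (meson sum.neutral)
  have *: "(if l = i then T l (j l) (k l) else of_bool (j l = k l)) \<noteq> 0" if "l \<in> I" for l
    using nz[unfolded prod_zero_iff[OF I]] that by blast
  have eq: "j l = k l" if "l \<in> I" "l \<noteq> i" for l using *[OF that(1)] that by auto
  have "j i = k i \<or> key i (j i) < key i (k i)"
    using *[OF i] tr[OF i] i 4 by (auto simp: triangularizes_def PiE_mem)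
  then show ?case
  proof
    assume "j i = k i"
    then have "j = k" using eq by (intro PiE_ext[OF 4(1,2)]) metis
    then show ?thesis ..
  next
    assume "key i (j i) < key i (k i)"
    then have "(\<Sum>l\<in>I. key l (j l)) < (\<Sum>l\<in>I. key l (k l))"
      using I i eq by (intro sum_strict_mono_ex1) (auto, metis order.refl less_imp_le)
    then show ?thesis ..
  qed
qed

lemma kron_sum_diag: "kron_sum I L u u = (\<Sum>i\<in>I. L i (u i) (u i))" if "finite I"
proof -
  have "(\<Prod>l\<in>I. if l = i then L l (u l) (u l) else of_bool (u l = u l)) = L i (u i) (u i)"
    if "i \<in> I" for i using that \<open>finite I\<close> by (simp cong: if_cong)
  then show ?thesis by (simp add: kron_sum_def)
qed

section \<open>The Laplacian spectrum and the characteristic polynomial\<close>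

lemma prod_linear_factors_dvd:
  fixes p :: "'a :: idom poly"
  shows "(\<Prod>x\<in>#proots p. [:- x, 1:]) dvd p"
proof (induction p rule: poly_root_order_induct)
  case (no_roots p)
  then have "proots p = {#}" by (simp add: multiset_eqI order_root)
  then show ?case by simp
next
  case (root p x n)
  then have "p \<noteq> 0" by auto
  then have "proots ([:- x, 1:] ^ n * p) = repeat_mset n {#x#} + proots p"
    by (simp add: proots_mult proots_power)
  moreover have "(\<Prod>y\<in>#repeat_mset n {#x#}. [:- y, 1:]) = [:- x, 1:] ^ n"
    by (induction n) auto
  ultimately show ?case using root by (simp add: mult_dvd_mono)
qed simp

text \<open>The product of linear factors divides \<open>p\<close>; equal degrees make the cofactor
  constant, and equal leading coefficients make it 1.\<close>

lemma prod_linear_factors_eq: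
  fixes p :: "'a :: idom poly"
  assumes "monic p" "size (proots p) = degree p"
  shows "p = (\<Prod>x\<in>#proots p. [:- x, 1:])"
proof -
  let ?q = "\<Prod>x\<in>#proots p. [:- x, 1:]"
  have q: "monic (\<Prod>x\<in>#M. [:- x, 1:]) \<and> degree (\<Prod>x\<in>#M. [:- x, 1:]) = size M" for M :: "'a multiset"
  proof (induction M)
    case (add x M)
    have "monic ([:- x, 1:] * (\<Prod>x\<in>#M. [:- x, 1:]))"
      using add by (intro monic_mult) auto
    moreover have "degree ([:- x, 1:] * (\<Prod>x\<in>#M. [:- x, 1:])) = Suc (size M)"
      using add by (subst degree_mult_eq) auto
    ultimately show ?case by simp
  qed simp
  obtain c where c: "p = ?q * c" using prod_linear_factors_dvd[of p] by (auto elim: dvdE)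
  then have "c \<noteq> 0" "?q \<noteq> 0" using assms(1) by auto
  then have "degree c = 0"
    using assms(2) c q[of "proots p"] degree_mult_eq[of ?q c] by simp
  then obtain a where "c = [:a:]" by (auto elim: degree_eq_zeroE)
  moreover from this c have "a = 1"
    using assms(1) q[of "proots p"] by (metis lead_coeff_mult lead_coeff_pCons(2) mult_1)
  ultimately show ?thesis using c by simp
qed

text \<open>Indexed by the vertices themselves, so that tuples of a product graph can be handled
  coordinate by coordinate, without an enumeration.\<close>

definition laplacian_entry :: "'a sgraph \<Rightarrow> 'a \<Rightarrow> 'a \<Rightarrow> real" where
  "laplacian_entry S u v =
     (if u = v then real (vertex_degree S u) else 0) - (if {u, v} \<in> edges S then esign S {u, v} else 0)"

lemma laplacian_matrix_eq_fun_mat: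
  assumes "finite (verts S)"
  shows "laplacian_matrix S = fun_mat (card (verts S)) (from_nat_into (verts S))
    (from_nat_into (verts S)) (laplacian_entry S)"
proof (rule eq_matI)
  let ?n = "card (verts S)" and ?e = "from_nat_into (verts S)"
  fix a b assume "a < dim_row (fun_mat ?n ?e ?e (laplacian_entry S))"
    "b < dim_col (fun_mat ?n ?e ?e (laplacian_entry S))"
  then have ab: "a < ?n" "b < ?n" by (auto simp: fun_mat_def)
  then have "?e a = ?e b \<longleftrightarrow> a = b"
    using bij_betw_from_nat_into_finite[OF assms] by (auto simp: bij_betw_def inj_on_def)
  with ab show "laplacian_matrix S $$ (a, b) = fun_mat ?n ?e ?e (laplacian_entry S) $$ (a, b)"
    by (simp add: fun_mat_def laplacian_matrix_def degree_matrix_def adjacency_matrix_def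
        laplacian_entry_def Let_def)
qed (auto simp: fun_mat_def laplacian_matrix_def degree_matrix_def adjacency_matrix_def)

text \<open>\<open>size_laplacian_eigenvalues\<close> supplies as many real roots as the degree,
  hence the polynomial splits over the reals.\<close>

lemma char_poly_laplacian_matrix:
  "finite (verts S) \<Longrightarrow>
    char_poly (laplacian_matrix S) = (\<Prod>x\<in>#laplacian_eigenvalues S. [:- x, 1:])"
proof -
  assume "finite (verts S)"
  then have "laplacian_matrix S \<in> carrier_mat (card (verts S)) (card (verts S))"
    by (simp add: laplacian_matrix_eq_fun_mat)
  from degree_monic_char_poly[OF this] show ?thesis
    unfolding laplacian_eigenvalues_def
    by (intro prod_linear_factors_eq) (auto simp: size_laplacian_eigenvalues[unfolded laplacian_eigenvalues_def])
qed

lemma laplacian_triangularizes: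
  assumes S: "finite (verts S)" and K: "finite K" "card K = card (verts S)"
    and ev: "laplacian_eigenvalues S = image_mset l (mset_set K)"
  shows "\<exists>F G T key. triangularizes (verts S) K (laplacian_entry S) F G T key \<and> (\<forall>k\<in>K. T k k = l k)"
proof (rule triangularizes_exists[OF bij_betw_from_nat_into_finite[OF S] K])
  show "char_poly (fun_mat (card (verts S)) (from_nat_into (verts S)) (from_nat_into (verts S))
    (laplacian_entry S)) = (\<Prod>k\<in>K. [:- l k, 1:])"
    unfolding laplacian_matrix_eq_fun_mat[OF S, symmetric] char_poly_laplacian_matrix[OF S] ev
    by (simp add: prod_unfold_prod_mset image_mset.compositionality comp_def)
qed

text \<open>Any triangularizing basis, however obtained, reveals the spectrum with multiplicities;
  the tensor basis of a product graph will be used here.\<close>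

lemma laplacian_eigenvalues_triangularizes:
  assumes S: "finite (verts S)" and K: "finite K" "card K = card (verts S)"
    and tr: "triangularizes (verts S) K (laplacian_entry S) F G T key"
  shows "laplacian_eigenvalues S = image_mset (\<lambda>k. T k k) (mset_set K)"
proof -
  have "laplacian_eigenvalues S = proots (\<Prod>k\<in>K. [:- T k k, 1:])"
    unfolding laplacian_eigenvalues_def laplacian_matrix_eq_fun_mat[OF S]
    by (subst char_poly_triangularizes[OF tr bij_betw_from_nat_into_finite[OF S] K]) simp
  also have "\<dots> = (\<Sum>k\<in>K. {#T k k#})"
    by (subst proots_prod) auto
  also have "\<dots> = image_mset (\<lambda>k. T k k) (mset_set K)"
    using K(1) by (induction K rule: finite_induct) auto
  finally show ?thesis .
qed

lemma triangularizes_cong: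
  assumes "\<And>u v. u \<in> V \<Longrightarrow> v \<in> V \<Longrightarrow> L u v = L' u v"
  shows "triangularizes V K L F G T key \<longleftrightarrow> triangularizes V K L' F G T key"
  using assms unfolding triangularizes_def by (auto cong: sum.cong)

section \<open>Vertex degrees and the handshake identity\<close>

lemma finite_edges: "signed_graph S \<Longrightarrow> finite (edges S)"
  by (rule finite_subset[of _ "Pow (verts S)"]) (auto simp: signed_graph_def)

lemma vertex_degree_eq_card_neighbours:
  assumes "signed_graph S"
  shows "vertex_degree S u = card {v \<in> verts S. {u, v} \<in> edges S}"
proof -
  have E: "e \<subseteq> verts S" "card e = 2" if "e \<in> edges S" for e
    using assms that by (auto simp: signed_graph_def)
  have "bij_betw (\<lambda>v. {u, v}) {v \<in> verts S. {u, v} \<in> edges S} {e \<in> edges S. u \<in> e}"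
    unfolding bij_betw_def
  proof
    show "inj_on (\<lambda>v. {u, v}) {v \<in> verts S. {u, v} \<in> edges S}"
      by (auto simp: inj_on_def doubleton_eq_iff)
    show "(\<lambda>v. {u, v}) ` {v \<in> verts S. {u, v} \<in> edges S} = {e \<in> edges S. u \<in> e}"
    proof (intro equalityI subsetI)
      fix e assume e: "e \<in> {e \<in> edges S. u \<in> e}"
      then obtain x y where xy: "e = {x, y}" using E(2)[of e] by (auto simp: card_2_iff)
      have "\<exists>v. e = {u, v}" using e xy by auto
      then show "e \<in> (\<lambda>v. {u, v}) ` {v \<in> verts S. {u, v} \<in> edges S}"
        using e E(1)[of e] by auto
    qed auto
  qed
  then show ?thesis unfolding vertex_degree_def by (simp add: bij_betw_same_card)
qed

text \<open>Double counting of incident pairs of a vertex and an edge.\<close>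

lemma sum_vertex_degree:
  assumes "signed_graph S"
  shows "(\<Sum>v\<in>verts S. vertex_degree S v) = 2 * card (edges S)"
proof -
  have fin: "finite (verts S)" and E: "\<And>e. e \<in> edges S \<Longrightarrow> e \<subseteq> verts S \<and> card e = 2"
    using assms by (auto simp: signed_graph_def)
  have "(\<Sum>v\<in>verts S. vertex_degree S v) = (\<Sum>v\<in>verts S. \<Sum>e | e \<in> edges S \<and> v \<in> e. 1)"
    by (simp add: vertex_degree_def)
  also have "\<dots> = (\<Sum>e\<in>edges S. \<Sum>v | v \<in> verts S \<and> v \<in> e. 1)"
    by (rule sum.swap_restrict[OF fin finite_edges[OF assms]])
  also have "\<dots> = (\<Sum>e\<in>edges S. 2)"
  proof (rule sum.cong[OF refl])
    fix e assume "e \<in> edges S"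
    with E have "{v. v \<in> verts S \<and> v \<in> e} = e" "card e = 2" by auto
    then show "(\<Sum>v | v \<in> verts S \<and> v \<in> e. 1) = (2::nat)" by simp
  qed
  finally show ?thesis by simp
qed

lemma no_loop: "signed_graph S \<Longrightarrow> {v} \<notin> edges S"
  by (auto simp: signed_graph_def)

section \<open>Degrees and Laplacian of the Cartesian product\<close>

lemma verts_cartesian_product:
  "verts (cartesian_product \<nu> S) = (\<Pi>\<^sub>E i\<in>{1..\<nu>}. verts (S i))"
  by (simp add: cartesian_product_def)

text \<open>An edge may be presented with its endpoints in either order; the condition on the right
  is symmetric in \<open>u\<close> and \<open>v\<close>.\<close>

lemma edges_cartesian_product_iff:
  assumes "u \<in> verts (cartesian_product \<nu> S)" "v \<in> verts (cartesian_product \<nu> S)"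
  shows "{u, v} \<in> edges (cartesian_product \<nu> S) \<longleftrightarrow>
    (\<exists>i\<in>{1..\<nu>}. {u i, v i} \<in> edges (S i) \<and> (\<forall>j\<in>{1..\<nu>} - {i}. u j = v j))"
  (is "?l \<longleftrightarrow> ?r")
proof
  assume ?l
  then obtain x y i where "{u, v} = {x, y}" and i: "i \<in> {1..\<nu>}" "{x i, y i} \<in> edges (S i)"
      "\<forall>j\<in>{1..\<nu>} - {i}. x j = y j"
    by (auto simp: cartesian_product_def)
  then have "u = x \<and> v = y \<or> u = y \<and> v = x" by (simp add: doubleton_eq_iff)
  then show ?r
  proof
    assume "u = y \<and> v = x"
    with i have "{u i, v i} \<in> edges (S i) \<and> (\<forall>j\<in>{1..\<nu>} - {i}. u j = v j)"
      by (simp add: insert_commute)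
    with i(1) show ?r by blast
  qed (use i in blast)
next
  assume ?r
  with assms show ?l by (auto simp: cartesian_product_def)
qed

text \<open>The neighbours of \<open>u\<close> arise by replacing one coordinate \<open>u i\<close>
  by a neighbour in the factor \<open>S i\<close>. The families for different \<open>i\<close> are
  disjoint because the factors have no loops.\<close>

lemma vertex_degree_cartesian_product:
  assumes S: "\<And>i. i \<in> {1..\<nu>} \<Longrightarrow> signed_graph (S i)"
    and u: "u \<in> verts (cartesian_product \<nu> S)"
  shows "vertex_degree (cartesian_product \<nu> S) u = (\<Sum>i\<in>{1..\<nu>}. vertex_degree (S i) (u i))"
proof -
  let ?P = "cartesian_product \<nu> S"
  define N where "N i = {x \<in> verts (S i). {u i, x} \<in> edges (S i)}" for i
  have uE: "u \<in> (\<Pi>\<^sub>E i\<in>{1..\<nu>}. verts (S i))" using u by (simp add: verts_cartesian_product)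
  have fin: "finite (N i)" if "i \<in> {1..\<nu>}" for i
    using S[OF that] by (auto simp: N_def signed_graph_def)
  have nu: "u i \<notin> N i" if "i \<in> {1..\<nu>}" for i
    using no_loop[OF S[OF that]] by (auto simp: N_def)
  have "{v \<in> verts ?P. {u, v} \<in> edges ?P} = (\<Union>i\<in>{1..\<nu>}. (\<lambda>x. u(i := x)) ` N i)"
  proof (intro equalityI subsetI)
    fix v assume "v \<in> {v \<in> verts ?P. {u, v} \<in> edges ?P}"
    then have v: "v \<in> verts ?P" "{u, v} \<in> edges ?P" by auto
    then obtain i where i: "i \<in> {1..\<nu>}" "{u i, v i} \<in> edges (S i)"
      "\<forall>j\<in>{1..\<nu>} - {i}. u j = v j"
      unfolding edges_cartesian_product_iff[OF u v(1)] by blast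
    have vE: "v \<in> (\<Pi>\<^sub>E i\<in>{1..\<nu>}. verts (S i))" using v by (simp add: verts_cartesian_product)
    \<comment> \<open>Outside the index range both tuples have the default value of extensional
      functions.\<close>
    have "v = u(i := v i)"
    proof
      fix j show "v j = (u(i := v i)) j"
        using i PiE_arb[OF uE, of j] PiE_arb[OF vE, of j] by (cases "j \<in> {1..\<nu>}") auto
    qed
    moreover have "v i \<in> N i" using i PiE_mem[OF vE i(1)] by (simp add: N_def)
    ultimately show "v \<in> (\<Union>i\<in>{1..\<nu>}. (\<lambda>x. u(i := x)) ` N i)" using i(1) by blast
  next
    fix v assume "v \<in> (\<Union>i\<in>{1..\<nu>}. (\<lambda>x. u(i := x)) ` N i)"
    then obtain i x where i: "i \<in> {1..\<nu>}" and x: "x \<in> N i" and v: "v = u(i := x)" by blast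
    have "v \<in> verts ?P"
      unfolding v verts_cartesian_product using i x PiE_mem[OF uE] PiE_arb[OF uE] by (auto simp: N_def)
    moreover from this have "{u, v} \<in> edges ?P"
      using i x v by (subst edges_cartesian_product_iff[OF u]) (auto simp: N_def)
    ultimately show "v \<in> {v \<in> verts ?P. {u, v} \<in> edges ?P}" by simp
  qed
  then have "vertex_degree ?P u = card (\<Union>i\<in>{1..\<nu>}. (\<lambda>x. u(i := x)) ` N i)"
    by (subst vertex_degree_eq_card_neighbours[OF signed_graph_cartesian_product[OF S]]) auto
  also have "\<dots> = (\<Sum>i\<in>{1..\<nu>}. card ((\<lambda>x. u(i := x)) ` N i))"
  proof (rule card_UN_disjoint)
    show "\<forall>i\<in>{1..\<nu>}. \<forall>j\<in>{1..\<nu>}. i \<noteq> j \<longrightarrow>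
      (\<lambda>x. u(i := x)) ` N i \<inter> (\<lambda>x. u(j := x)) ` N j = {}"
    proof (intro ballI impI equals0I)
      fix i j f assume ij: "i \<in> {1..\<nu>}" "j \<in> {1..\<nu>}" "i \<noteq> j"
        and "f \<in> (\<lambda>x. u(i := x)) ` N i \<inter> (\<lambda>x. u(j := x)) ` N j"
      then obtain x y where "x \<in> N i" "u(i := x) = u(j := y)" by auto
      \<comment> \<open>Evaluated at \<open>i\<close>, the update at \<open>j\<close> leaves
        \<open>u i\<close> unchanged, so \<open>u i\<close> would be its own neighbour.\<close>
      then have "x = u i" using ij by (metis fun_upd_apply)
      with \<open>x \<in> N i\<close> nu[OF ij(1)] show False by simp
    qed
  qed (use fin in auto)
  also have "\<dots> = (\<Sum>i\<in>{1..\<nu>}. vertex_degree (S i) (u i))"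
  proof (rule sum.cong[OF refl])
    fix i assume "i \<in> {1..\<nu>}"
    moreover have "inj_on (\<lambda>x. u(i := x)) (N i)" by (auto simp: inj_on_def dest: fun_upd_eqD)
    ultimately show "card ((\<lambda>x. u(i := x)) ` N i) = vertex_degree (S i) (u i)"
      using S by (simp add: card_image vertex_degree_eq_card_neighbours N_def)
  qed
  finally show ?thesis .
qed

text \<open>On the diagonal this is additivity of degrees. Off the diagonal, with \<open>u\<close>
  and \<open>v\<close> differing at \<open>i\<close>, only summand \<open>i\<close> can survive, and
  it does so only if all other coordinates agree, which is the adjacency condition of the
  product.\<close>

lemma laplacian_entry_cartesian_product:
  assumes S: "\<And>i. i \<in> {1..\<nu>} \<Longrightarrow> signed_graph (S i)"
    and u: "u \<in> verts (cartesian_product \<nu> S)" and v: "v \<in> verts (cartesian_product \<nu> S)"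
  shows "laplacian_entry (cartesian_product \<nu> S) u v =
    kron_sum {1..\<nu>} (\<lambda>i. laplacian_entry (S i)) u v"
proof (cases "u = v")
  case True
  have "{u} \<notin> edges (cartesian_product \<nu> S)"
    by (rule no_loop[OF signed_graph_cartesian_product[OF S]])
  moreover have "vertex_degree (cartesian_product \<nu> S) u = (\<Sum>i\<in>{1..\<nu>}. vertex_degree (S i) (u i))"
    by (rule vertex_degree_cartesian_product[OF S u])
  ultimately have "laplacian_entry (cartesian_product \<nu> S) u u = (\<Sum>i\<in>{1..\<nu>}. real (vertex_degree (S i) (u i)))"
    by (simp add: laplacian_entry_def)
  also have "\<dots> = (\<Sum>i\<in>{1..\<nu>}. laplacian_entry (S i) (u i) (u i))"
    using no_loop[OF S] by (intro sum.cong) (auto simp: laplacian_entry_def)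
  finally show ?thesis using True by (simp add: kron_sum_diag)
next
  case False
  let ?P = "cartesian_product \<nu> S" and ?I = "{1..\<nu>}"
  let ?t = "\<lambda>i l. if l = i then laplacian_entry (S l) (u l) (v l) else of_bool (u l = v l)"
  have "u \<in> (\<Pi>\<^sub>E i\<in>?I. verts (S i))" "v \<in> (\<Pi>\<^sub>E i\<in>?I. verts (S i))"
    using u v by (simp_all add: verts_cartesian_product)
  with False obtain i where i: "i \<in> ?I" "u i \<noteq> v i" using PiE_ext by blast
  \<comment> \<open>Such a product contains the factor \<open>of_bool (u i = v i)\<close>, which is
    0.\<close>
  have other: "(\<Prod>l\<in>?I. ?t k l) = 0" if "k \<in> ?I - {i}" for k
    using i that by (intro prod_zero bexI[of _ i]) auto
  have "kron_sum ?I (\<lambda>i. laplacian_entry (S i)) u v = (\<Sum>k\<in>?I. if k = i then (\<Prod>l\<in>?I. ?t i l) else 0)"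
    unfolding kron_sum_def using other by (intro sum.cong) auto
  then have ks: "kron_sum ?I (\<lambda>i. laplacian_entry (S i)) u v = (\<Prod>l\<in>?I. ?t i l)"
    using i(1) by simp
  show ?thesis
  proof (cases "\<forall>j\<in>?I - {i}. u j = v j")
    case True
    then have "(\<Prod>l\<in>?I. ?t i l) = (\<Prod>l\<in>?I. if l = i then laplacian_entry (S i) (u i) (v i) else 1)"
      by (intro prod.cong) auto
    then have "kron_sum ?I (\<lambda>i. laplacian_entry (S i)) u v = laplacian_entry (S i) (u i) (v i)"
      using ks i(1) by simp
    moreover have "{u, v} \<in> edges ?P \<longleftrightarrow> {u i, v i} \<in> edges (S i)"
      unfolding edges_cartesian_product_iff[OF u v] using True i by blast
    moreover have "esign ?P {u, v} = esign (S i) {u i, v i}" if "{u i, v i} \<in> edges (S i)"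
      using True by (intro cartesian_product_esign[of \<nu> S i u v, OF S i(1) that]) auto
    ultimately show ?thesis using False i by (simp add: laplacian_entry_def)
  next
    case no: False
    then obtain j where j: "j \<in> ?I" "j \<noteq> i" "u j \<noteq> v j" by blast
    then have "(\<Prod>l\<in>?I. ?t i l) = 0" by (intro prod_zero bexI[of _ j]) auto
    moreover have "{u, v} \<notin> edges ?P"
      unfolding edges_cartesian_product_iff[OF u v] using i j by blast
    ultimately show ?thesis using ks False by (simp add: laplacian_entry_def)
  qed
qed

section \<open>Additivity of the average degree\<close>

text \<open>Each value of coordinate \<open>i\<close> occurs in equally many tuples, so averaging
  over tuples is averaging over that coordinate. Used for both the average degree and the energy
  bound.\<close>

lemma sum_PiE_coord:
  fixes h :: "'b \<Rightarrow> real"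
  assumes I: "finite I" and V: "\<And>l. l \<in> I \<Longrightarrow> finite (V l) \<and> V l \<noteq> {}" and i: "i \<in> I"
  shows "(\<Sum>u\<in>PiE I V. h (u i)) / (\<Prod>l\<in>I. real (card (V l))) = (\<Sum>x\<in>V i. h x) / card (V i)"
proof -
  \<comment> \<open>Padding with factors 1 in the other coordinates makes the exchange of sum and
    product applicable.\<close>
  have "(\<Sum>u\<in>PiE I V. h (u i)) = (\<Sum>u\<in>PiE I V. \<Prod>l\<in>I. if l = i then h (u l) else 1)"
    using I i by (intro sum.cong) auto
  also have "\<dots> = (\<Prod>l\<in>I. \<Sum>x\<in>V l. if l = i then h x else 1)"
    using I V by (subst prod_sum_PiE) auto
  also have "\<dots> = (\<Sum>x\<in>V i. h x) * (\<Prod>l\<in>I - {i}. real (card (V l)))"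
    by (subst prod.remove[OF I i]) auto
  finally have eq: "(\<Sum>u\<in>PiE I V. h (u i)) = (\<Sum>x\<in>V i. h x) * (\<Prod>l\<in>I - {i}. real (card (V l)))" .
  have "(\<Prod>l\<in>I - {i}. real (card (V l))) \<noteq> 0" using I V by auto
  then show ?thesis
    unfolding eq by (subst prod.remove[OF I i]) simp
qed

lemma avg_degree_eq:
  "signed_graph S \<Longrightarrow> avg_degree S = (\<Sum>v\<in>verts S. real (vertex_degree S v)) / card (verts S)"
  using sum_vertex_degree[of S] by (simp add: avg_degree_def flip: of_nat_sum)

lemma avg_degree_cartesian_product:
  assumes S: "\<And>i. i \<in> {1..\<nu>} \<Longrightarrow> signed_graph (S i)"
  shows "avg_degree (cartesian_product \<nu> S) = (\<Sum>i\<in>{1..\<nu>}. avg_degree (S i))"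
proof -
  let ?P = "cartesian_product \<nu> S" and ?I = "{1..\<nu>}"
  let ?V = "\<Pi>\<^sub>E i\<in>?I. verts (S i)" and ?n = "\<Prod>i\<in>?I. real (card (verts (S i)))"
  have "avg_degree ?P = (\<Sum>u\<in>verts ?P. real (vertex_degree ?P u)) / card (verts ?P)"
    by (rule avg_degree_eq[OF signed_graph_cartesian_product[OF S]])
  also have "(\<Sum>u\<in>verts ?P. real (vertex_degree ?P u)) =
      (\<Sum>u\<in>verts ?P. \<Sum>i\<in>?I. real (vertex_degree (S i) (u i)))"
    by (intro sum.cong refl) (subst vertex_degree_cartesian_product[OF S], auto)
  also have "\<dots> = (\<Sum>i\<in>?I. \<Sum>u\<in>?V. real (vertex_degree (S i) (u i)))"
    unfolding verts_cartesian_product by (rule sum.swap)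
  also have "real (card (verts ?P)) = ?n"
    by (simp add: verts_cartesian_product card_PiE)
  also have "(\<Sum>i\<in>?I. \<Sum>u\<in>?V. real (vertex_degree (S i) (u i))) / ?n =
      (\<Sum>i\<in>?I. avg_degree (S i))"
    unfolding sum_divide_distrib
  proof (rule sum.cong[OF refl])
    fix i assume i: "i \<in> ?I"
    show "(\<Sum>u\<in>?V. real (vertex_degree (S i) (u i)) / ?n) = avg_degree (S i)"
      unfolding avg_degree_eq[OF S[OF i]] sum_divide_distrib[symmetric]
      using S by (intro sum_PiE_coord i) (auto simp: signed_graph_def)
  qed
  finally show ?thesis .
qed

section \<open>Power sums of the Laplacian eigenvalues\<close>

lemma sum_laplacian_entry_diag:
  assumes "signed_graph S"
  shows "(\<Sum>u\<in>verts S. laplacian_entry S u u) = avg_degree S * card (verts S)"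
proof -
  have "card (verts S) \<noteq> 0" using assms by (auto simp: signed_graph_def)
  then show ?thesis
    using no_loop[OF assms] by (simp add: avg_degree_eq[OF assms] laplacian_entry_def)
qed

text \<open>The diagonal contributes the squared degrees. Each ordered adjacent pair contributes a
  squared sign, that is 1, whence twice the number of edges.\<close>

lemma sum_laplacian_entry_square:
  assumes "signed_graph S"
  shows "(\<Sum>u\<in>verts S. \<Sum>v\<in>verts S. laplacian_entry S u v * laplacian_entry S v u) =
    (\<Sum>u\<in>verts S. (real (vertex_degree S u))\<^sup>2) + 2 * real (card (edges S))"
proof -
  let ?d = "\<lambda>u. real (vertex_degree S u)"
  have fin: "finite (verts S)" using assms by (simp add: signed_graph_def)
  have "(\<Sum>v\<in>verts S. laplacian_entry S u v * laplacian_entry S v u) = (?d u)\<^sup>2 + ?d u"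
    if "u \<in> verts S" for u
  proof -
    have "laplacian_entry S u v * laplacian_entry S v u =
        (if v = u then (?d u)\<^sup>2 else 0) + (if {u, v} \<in> edges S then 1 else 0)" for v
    proof (cases "u = v")
      case True
      then show ?thesis
        using no_loop[OF assms] by (simp add: laplacian_entry_def power2_eq_square)
    next
      case False
      moreover have "{u, v} \<in> edges S \<Longrightarrow> esign S {u, v} * esign S {u, v} = 1"
        using assms by (auto simp: signed_graph_def)
      ultimately show ?thesis by (simp add: laplacian_entry_def insert_commute)
    qed
    then show ?thesis
      using fin that
      by (simp add: sum.distrib vertex_degree_eq_card_neighbours[OF assms] sum.inter_filter[symmetric])
  qed
  then show ?thesis
    using sum_vertex_degree[OF assms] by (simp add: sum.distrib flip: of_nat_sum)
qed

lemma laplacian_eigenvalue_sum: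
  assumes S: "signed_graph S" and K: "finite K" "card K = card (verts S)"
    and ev: "laplacian_eigenvalues S = image_mset l (mset_set K)"
  shows "(\<Sum>k\<in>K. l k) = avg_degree S * card (verts S)"
    and "(\<Sum>k\<in>K. (l k)\<^sup>2) = (\<Sum>u\<in>verts S. (real (vertex_degree S u))\<^sup>2) + 2 * real (card (edges S))"
proof -
  have fin: "finite (verts S)" using S by (simp add: signed_graph_def)
  obtain F G T key where tr: "triangularizes (verts S) K (laplacian_entry S) F G T key"
    and T: "\<forall>k\<in>K. T k k = l k"
    using laplacian_triangularizes[OF fin K ev] by blast
  show "(\<Sum>k\<in>K. l k) = avg_degree S * card (verts S)"
    using trace_triangularizes(1)[OF tr fin K(1)] sum_laplacian_entry_diag[OF S] T by simp
  show "(\<Sum>k\<in>K. (l k)\<^sup>2) = (\<Sum>u\<in>verts S. (real (vertex_degree S u))\<^sup>2) + 2 * real (card (edges S))"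
    using trace_triangularizes(2)[OF tr fin K(1)] sum_laplacian_entry_square[OF S] T by simp
qed

text \<open>If all eigenvalues equal the average degree \<open>a\<close>, then \<open>tr L\<^sup>2 = n a\<^sup>2\<close>; but \<open>tr L\<^sup>2\<close> is the sum
  of the squared degrees, at least \<open>n a\<^sup>2\<close>, plus twice the number of edges.\<close>

lemma laplacian_eigenvalues_not_all_avg:
  assumes S: "signed_graph S" and K: "finite K" "card K = card (verts S)"
    and ev: "laplacian_eigenvalues S = image_mset l (mset_set K)" and E: "edges S \<noteq> {}"
  shows "\<exists>k\<in>K. l k \<noteq> avg_degree S"
proof (rule ccontr)
  let ?a = "avg_degree S" and ?d = "\<lambda>u. real (vertex_degree S u)" and ?n = "real (card (verts S))"
  assume "\<not> (\<exists>k\<in>K. l k \<noteq> ?a)"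
  then have "(\<Sum>k\<in>K. (l k)\<^sup>2) = ?n * ?a\<^sup>2" using K by simp
  moreover have "?n * ?a\<^sup>2 \<le> (\<Sum>u\<in>verts S. (?d u)\<^sup>2)"
  proof -
    have "?n \<noteq> 0" using S by (auto simp: signed_graph_def)
    then have d: "(\<Sum>u\<in>verts S. ?d u) = ?n * ?a" by (simp add: avg_degree_eq[OF S])
    \<comment> \<open>Nonnegativity of the variance of the degrees, whose mean is
      \<open>?a\<close>.\<close>
    have "0 \<le> (\<Sum>u\<in>verts S. (?d u - ?a)\<^sup>2)" by (intro sum_nonneg) simp
    also have "\<dots> = (\<Sum>u\<in>verts S. (?d u)\<^sup>2) - 2 * (\<Sum>u\<in>verts S. ?d u) * ?a + ?n * ?a\<^sup>2"
      by (simp add: power2_diff sum.distrib sum_subtractf sum_distrib_left sum_distrib_right)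
    also have "\<dots> = (\<Sum>u\<in>verts S. (?d u)\<^sup>2) - ?n * ?a\<^sup>2"
      unfolding d by (simp add: power2_eq_square)
    finally show ?thesis by simp
  qed
  moreover have "card (edges S) > 0"
    using E finite_edges[OF S] by (simp add: card_gt_0_iff)
  ultimately show False using laplacian_eigenvalue_sum(2)[OF S K ev] by simp
qed

text \<open>The mean of the eigenvalues is the average degree and some eigenvalue differs from it;
  were all of them on one side, the mean would be off strictly.\<close>

lemma laplacian_eigenvalue_both_sides:
  assumes S: "signed_graph S" and K: "finite K" "card K = card (verts S)"
    and ev: "laplacian_eigenvalues S = image_mset l (mset_set K)" and E: "edges S \<noteq> {}"
  shows "\<exists>k\<in>K. avg_degree S < l k" "\<exists>k\<in>K. l k < avg_degree S"
proof -
  obtain k where k: "k \<in> K" "l k \<noteq> avg_degree S"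
    using laplacian_eigenvalues_not_all_avg[OF assms] by blast
  have sum: "(\<Sum>k\<in>K. l k) = (\<Sum>k\<in>K. avg_degree S)"
    using laplacian_eigenvalue_sum(1)[OF S K ev] K by simp
  show "\<exists>k\<in>K. avg_degree S < l k"
  proof (rule ccontr)
    assume "\<not> ?thesis"
    then have "(\<Sum>k\<in>K. l k) < (\<Sum>k\<in>K. avg_degree S)"
      using k K(1) by (intro sum_strict_mono_ex1) (auto simp: not_less intro!: bexI[of _ k])
    with sum show False by simp
  qed
  show "\<exists>k\<in>K. l k < avg_degree S"
  proof (rule ccontr)
    assume "\<not> ?thesis"
    then have "(\<Sum>k\<in>K. avg_degree S) < (\<Sum>k\<in>K. l k)"
      using k K(1) by (intro sum_strict_mono_ex1) (auto simp: not_less intro!: bexI[of _ k])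
    with sum show False by simp
  qed
qed

section \<open>The spectrum of the product\<close>

text \<open>One triangularization is chosen per factor; their tensor product triangularizes the
  Laplacian of the product, and its diagonal is read off.\<close>

lemma laplacian_eigenvalues_cartesian_product:
  assumes S: "\<And>i. i \<in> {1..\<nu>} \<Longrightarrow> signed_graph (S i)"
    and K: "\<And>i. i \<in> {1..\<nu>} \<Longrightarrow> finite (K i) \<and> card (K i) = card (verts (S i))"
    and ev: "\<And>i. i \<in> {1..\<nu>} \<Longrightarrow> laplacian_eigenvalues (S i) = image_mset (l i) (mset_set (K i))"
  shows "laplacian_eigenvalues (cartesian_product \<nu> S) =
    image_mset (\<lambda>j. \<Sum>i\<in>{1..\<nu>}. l i (j i)) (mset_set (\<Pi>\<^sub>E i\<in>{1..\<nu>}. K i))"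
proof -
  let ?P = "cartesian_product \<nu> S" and ?I = "{1..\<nu>}"
  have fin: "finite (verts (S i))" if "i \<in> ?I" for i using S[OF that] by (simp add: signed_graph_def)
  have finP: "finite (verts ?P)"
    using signed_graph_cartesian_product[OF S] by (simp add: signed_graph_def)
  have "\<forall>i\<in>?I. \<exists>F G T key. triangularizes (verts (S i)) (K i) (laplacian_entry (S i)) F G T key \<and>
      (\<forall>k\<in>K i. T k k = l i k)"
    using laplacian_triangularizes fin K ev by blast
  then obtain F G T key where
    tr: "\<And>i. i \<in> ?I \<Longrightarrow> triangularizes (verts (S i)) (K i) (laplacian_entry (S i)) (F i) (G i) (T i) (key i)"
    and T: "\<And>i k. i \<in> ?I \<Longrightarrow> k \<in> K i \<Longrightarrow> T i k k = l i k"
    by (metis (no_types))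
  have finK: "finite (PiE ?I K)" using K by (intro finite_PiE) auto
  have card: "card (PiE ?I K) = card (verts ?P)"
    using K by (simp add: verts_cartesian_product card_PiE)
  have "triangularizes (PiE ?I (\<lambda>i. verts (S i))) (PiE ?I K) (kron_sum ?I (\<lambda>i. laplacian_entry (S i)))
      (\<lambda>u j. \<Prod>i\<in>?I. F i (u i) (j i)) (\<lambda>j u. \<Prod>i\<in>?I. G i (j i) (u i))
      (kron_sum ?I T) (\<lambda>j. \<Sum>i\<in>?I. key i (j i))"
    using K fin tr by (intro triangularizes_kron_sum) auto
  then have "triangularizes (verts ?P) (PiE ?I K) (laplacian_entry ?P)
      (\<lambda>u j. \<Prod>i\<in>?I. F i (u i) (j i)) (\<lambda>j u. \<Prod>i\<in>?I. G i (j i) (u i))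
      (kron_sum ?I T) (\<lambda>j. \<Sum>i\<in>?I. key i (j i))"
    by (subst triangularizes_cong[OF laplacian_entry_cartesian_product[OF S]])
      (simp_all add: verts_cartesian_product)
  from laplacian_eigenvalues_triangularizes[OF finP finK card this]
  have "laplacian_eigenvalues ?P = image_mset (\<lambda>j. kron_sum ?I T j j) (mset_set (PiE ?I K))" .
  also have "\<dots> = image_mset (\<lambda>j. \<Sum>i\<in>?I. l i (j i)) (mset_set (PiE ?I K))"
  proof (rule image_mset_cong)
    fix j assume "j \<in># mset_set (PiE ?I K)"
    then have j: "j \<in> PiE ?I K" using finK by simp
    have "kron_sum ?I T j j = (\<Sum>i\<in>?I. T i (j i) (j i))" by (simp add: kron_sum_diag)
    also have "\<dots> = (\<Sum>i\<in>?I. l i (j i))"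
      using T PiE_mem[OF j] by (intro sum.cong) auto
    finally show "kron_sum ?I T j j = (\<Sum>i\<in>?I. l i (j i))" .
  qed
  finally show ?thesis .
qed

section \<open>The energy inequality and strictness\<close>

text \<open>The negative term makes the upper bound on the sum strict, the positive term the upper
  bound on its negative.\<close>

lemma abs_sum_less_sum_abs:
  fixes f :: "'b \<Rightarrow> real"
  assumes "finite I" "a \<in> I" "b \<in> I" "f a < 0" "0 < f b"
  shows "\<bar>\<Sum>i\<in>I. f i\<bar> < (\<Sum>i\<in>I. \<bar>f i\<bar>)"
proof -
  have "(\<Sum>i\<in>I. f i) < (\<Sum>i\<in>I. \<bar>f i\<bar>)"
    using assms by (intro sum_strict_mono_ex1) (auto intro!: bexI[of _ a])
  moreover have "(\<Sum>i\<in>I. - f i) < (\<Sum>i\<in>I. \<bar>f i\<bar>)"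
    using assms by (intro sum_strict_mono_ex1) (auto intro!: bexI[of _ b])
  ultimately show ?thesis by (simp add: sum_negf abs_less_iff)
qed

theorem corollary3p8:
  fixes \<nu> :: nat
    and S :: "nat \<Rightarrow> 'a sgraph"
    and ev :: "nat \<Rightarrow> nat \<Rightarrow> real"
    and P :: "(nat \<Rightarrow> 'a) sgraph"
    and n :: nat
  assumes "1 \<le> \<nu>"
    and "\<And>i. i \<in> {1..\<nu>} \<Longrightarrow> signed_graph (S i)"
    and "\<And>i. i \<in> {1..\<nu>} \<Longrightarrow>
           laplacian_eigenvalues (S i) = image_mset (ev i) (mset_set {1..card (verts (S i))})"
    and "P = cartesian_product \<nu> S"
    and "n = (\<Prod>i\<in>{1..\<nu>}. card (verts (S i)))"
  shows "laplacian_energy P =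
           (\<Sum>j\<in>(\<Pi>\<^sub>E i\<in>{1..\<nu>}. {1..card (verts (S i))}).
              \<bar>(\<Sum>i\<in>{1..\<nu>}. ev i (j i)) - avg_degree P\<bar>)
       \<and> laplacian_energy P / real n \<le>
           (\<Sum>i\<in>{1..\<nu>}. laplacian_energy (S i) / real (card (verts (S i))))
       \<and> (\<not> (\<nu> = 1 \<or> card {i \<in> {1..\<nu>}. edges (S i) \<noteq> {}} \<le> 1) \<longrightarrow>
           laplacian_energy P / real n <
           (\<Sum>i\<in>{1..\<nu>}. laplacian_energy (S i) / real (card (verts (S i)))))"
proof -
  note S = assms(2) and ev = assms(3) and P = assms(4) and n = assms(5)
  let ?I = "{1..\<nu>}"
  define K where "K = (\<lambda>i. {1..card (verts (S i))})"
  define J where "J = PiE ?I K"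
  define x where "x = (\<lambda>i k. ev i k - avg_degree (S i))"
  have V: "finite (verts (S i))" "verts (S i) \<noteq> {}" if "i \<in> ?I" for i
    using S[OF that] by (auto simp: signed_graph_def)
  have K: "finite (K i)" "K i \<noteq> {}" "card (K i) = card (verts (S i))" if "i \<in> ?I" for i
    using V[OF that] by (auto simp: K_def Suc_le_eq card_gt_0_iff)
  have finJ: "finite J" unfolding J_def using K by (intro finite_PiE) auto
  have "n > 0" unfolding n using V by (intro prod_pos) (auto simp: card_gt_0_iff)
  have eig: "laplacian_eigenvalues P = image_mset (\<lambda>j. \<Sum>i\<in>?I. ev i (j i)) (mset_set J)"
    unfolding P J_def using S K ev
    by (intro laplacian_eigenvalues_cartesian_product) (auto simp: K_def)
  have energy: "laplacian_energy P = (\<Sum>j\<in>J. \<bar>(\<Sum>i\<in>?I. ev i (j i)) - avg_degree P\<bar>)"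
    by (simp add: laplacian_energy_def eig image_mset.compositionality comp_def sum_unfold_sum_mset)
  moreover have "avg_degree P = (\<Sum>i\<in>?I. avg_degree (S i))"
    unfolding P by (rule avg_degree_cartesian_product[OF S])
  ultimately have energy': "laplacian_energy P = (\<Sum>j\<in>J. \<bar>\<Sum>i\<in>?I. x i (j i)\<bar>)"
    by (simp add: x_def sum_subtractf)
  \<comment> \<open>The right-hand side of the inequality is rewritten as an average over all index
    tuples, so that it can be compared with the energy of \<open>P\<close> tuple by tuple.\<close>
  have bound: "(\<Sum>j\<in>J. \<Sum>i\<in>?I. \<bar>x i (j i)\<bar>) / n =
      (\<Sum>i\<in>?I. laplacian_energy (S i) / card (verts (S i)))"
  proof -
    have "(\<Sum>j\<in>J. \<Sum>i\<in>?I. \<bar>x i (j i)\<bar>) / n = (\<Sum>i\<in>?I. (\<Sum>j\<in>J. \<bar>x i (j i)\<bar>) / n)"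
      by (subst sum.swap) (simp add: sum_divide_distrib)
    also have "\<dots> = (\<Sum>i\<in>?I. laplacian_energy (S i) / card (verts (S i)))"
    proof (rule sum.cong[OF refl])
      fix i assume i: "i \<in> ?I"
      have "real n = (\<Prod>l\<in>?I. real (card (K l)))" using K by (simp add: n)
      then have "(\<Sum>j\<in>J. \<bar>x i (j i)\<bar>) / n = (\<Sum>k\<in>K i. \<bar>x i k\<bar>) / card (K i)"
        unfolding J_def using sum_PiE_coord[of ?I K i "\<lambda>k. \<bar>x i k\<bar>"] K i by simp
      also have "(\<Sum>k\<in>K i. \<bar>x i k\<bar>) = laplacian_energy (S i)"
        unfolding laplacian_energy_def ev[OF i]
        by (simp add: x_def K_def image_mset.compositionality comp_def sum_unfold_sum_mset)
      finally show "(\<Sum>j\<in>J. \<bar>x i (j i)\<bar>) / n = laplacian_energy (S i) / card (verts (S i))"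
        using K(3)[OF i] by simp
    qed
    finally show ?thesis .
  qed
  have "(\<Sum>j\<in>J. \<bar>\<Sum>i\<in>?I. x i (j i)\<bar>) \<le> (\<Sum>j\<in>J. \<Sum>i\<in>?I. \<bar>x i (j i)\<bar>)"
    by (intro sum_mono sum_abs)
  then have le: "laplacian_energy P / n \<le> (\<Sum>i\<in>?I. laplacian_energy (S i) / card (verts (S i)))"
    unfolding bound[symmetric] energy' by (intro divide_right_mono) auto
  have less: "laplacian_energy P / n < (\<Sum>i\<in>?I. laplacian_energy (S i) / card (verts (S i)))"
    if "\<not> card {i \<in> ?I. edges (S i) \<noteq> {}} \<le> 1"
  proof -
    from that obtain a b where ab: "a \<in> ?I" "edges (S a) \<noteq> {}" "b \<in> ?I" "edges (S b) \<noteq> {}" "a \<noteq> b"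
      using card_le_Suc0_iff_eq[of "{i \<in> ?I. edges (S i) \<noteq> {}}"] by auto
    obtain p where p: "p \<in> K a" "x a p < 0"
      using laplacian_eigenvalue_both_sides(2)[OF S K(1,3) _ ab(2), of "ev a"] ev ab(1)
      by (auto simp: x_def K_def)
    obtain q where q: "q \<in> K b" "0 < x b q"
      using laplacian_eigenvalue_both_sides(1)[OF S K(1,3) _ ab(4), of "ev b"] ev ab(3)
      by (auto simp: x_def K_def)
    obtain j0 where "j0 \<in> J"
      unfolding J_def using K(2) PiE_eq_empty_iff[of ?I K] by blast
    \<comment> \<open>An arbitrary tuple is altered to have a negative deviation at \<open>a\<close>
      and a positive one at \<open>b\<close>; since \<open>a \<noteq> b\<close>, the second update
      keeps the first.\<close>
    define j where "j = j0(a := p, b := q)"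
    have j: "j \<in> J"
      using \<open>j0 \<in> J\<close> p q ab by (auto simp: J_def j_def PiE_iff extensional_def)
    have "x a (j a) < 0" "0 < x b (j b)" using p q ab by (simp_all add: j_def)
    then have "\<bar>\<Sum>i\<in>?I. x i (j i)\<bar> < (\<Sum>i\<in>?I. \<bar>x i (j i)\<bar>)"
      using ab by (intro abs_sum_less_sum_abs[of _ a b]) auto
    \<comment> \<open>Strictness at the single tuple \<open>j\<close> suffices; all other tuples
      satisfy the weak inequality.\<close>
    then have "(\<Sum>j\<in>J. \<bar>\<Sum>i\<in>?I. x i (j i)\<bar>) < (\<Sum>j\<in>J. \<Sum>i\<in>?I. \<bar>x i (j i)\<bar>)"
      using j finJ by (intro sum_strict_mono_ex1 ballI sum_abs) auto
    then show ?thesis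
      unfolding bound[symmetric] energy' using \<open>n > 0\<close> by (intro divide_strict_right_mono) auto
  qed
  show ?thesis
    using energy le less unfolding J_def K_def by blast
qed

end
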